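(* Let $(\mathcal{N},[\cdot,\dots,\cdot]_\mathcal{N},B)$ be a quadratic $n$-ary Nambu-Lie algebra and let $\mathcal{N}^*$ be the dual vector space of $\mathcal{N}$. For $x_1,\dots,x_{n-1}\in\mathcal{N}$ let $L(x_1,\dots,x_{n-1})\in End(\mathcal{N})$ be given by $L(x_1,\dots,x_{n-1})(z)=[x_1,\dots,x_{n-1},z]_\mathcal{N}$. Then the vector space $\mathcal{L}=\mathcal{N}\oplus\mathcal{N}^*$, equipped with the product $[\cdot,\dots,\cdot]_\mathcal{L}:\mathcal{L}^n\to\mathcal{L}$ given, for $u_i=x_i+f_i$ with $x_i\in\mathcal{N}$, $f_i\in\mathcal{N}^*$, by $$[u_1,\dots,u_n]_\mathcal{L}=[x_1,\dots,x_n]_\mathcal{N}+\sum_{i=1}^n(-1)^{i+n+1}f_i\circ L(x_1,\dots,\widehat{x_i},\dots,x_n)$$ (where $\widehat{x_i}$ means that $x_i$ is omitted) and with the bilinear form $B_\mathcal{L}:\mathcal{L}\times\mathcal{L}\to\mathbb{K}$, $$B_\mathcal{L}(x+f,y+g)=B(x,y)+f(y)+g(x),$$ is a quadratic $n$-ary Nambu algebra.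
   Context: $\mathbb{K}$ is an algebraically closed field of characteristic zero and $n\ge 2$. An $n$-ary Nambu algebra is a $\mathbb{K}$-vector space $\mathcal{N}$ with an $n$-linear bracket satisfying $$[x_1,\dots,x_{n-1},[y_1,\dots,y_n]]=\sum_{i=1}^n[y_1,\dots,y_{i-1},[x_1,\dots,x_{n-1},y_i],y_{i+1},\dots,y_n].$$ It is an $n$-ary Nambu-Lie algebra if in addition the bracket is skew-symmetric: $[x_{\sigma(1)},\dots,x_{\sigma(n)}]=Sgn(\sigma)[x_1,\dots,x_n]$ for all $\sigma\in\mathcal{S}_n$. It is quadratic with respect to $B$ if $B$ is a nondegenerate symmetric bilinear form such that $B([x_1,\dots,x_{n-1},y],z)+B(y,[x_1,\dots,x_{n-1},z])=0$ for all elements. *)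

theory Defs
  imports
    Main
    "HOL-Computational_Algebra.Polynomial"
    "HOL-Combinatorics.Permutations"
    "HOL-Library.Function_Algebras"
    "HOL-Library.Product_Plus"
begin

text \<open>
  The underlying vector space is a subspace \<open>V\<close> of an ambient vector space given by \<open>scale\<close>.
  The \<open>n\<close>-ary bracket takes its arguments as a list; only lists of length \<open>n\<close> with entries in
  \<open>V\<close> are constrained. List positions start at 0, so the mathematical index \<open>i\<close> is position
  \<open>i - 1\<close>.
\<close>

locale nambu_algebra = vector_space scale
  for scale :: "'k::field \<Rightarrow> 'v::ab_group_add \<Rightarrow> 'v" +
  fixes n :: nat
    and V :: "'v set"
    and br :: "'v list \<Rightarrow> 'v"
  assumes arity: "2 \<le> n"
    and subspace_V: "subspace V"
    and bracket_closed:
      "\<lbrakk>length xs = n; set xs \<subseteq> V\<rbrakk> \<Longrightarrow> br xs \<in> V"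
    and bracket_add:
      "\<lbrakk>length xs = n; set xs \<subseteq> V; i < n; a \<in> V; b \<in> V\<rbrakk>
        \<Longrightarrow> br (xs[i := a + b]) = br (xs[i := a]) + br (xs[i := b])"
    and bracket_scale:
      "\<lbrakk>length xs = n; set xs \<subseteq> V; i < n; a \<in> V\<rbrakk>
        \<Longrightarrow> br (xs[i := scale c a]) = scale c (br (xs[i := a]))"
    and nambu_identity:
      "\<lbrakk>length xs = n - 1; set xs \<subseteq> V; length ys = n; set ys \<subseteq> V\<rbrakk>
        \<Longrightarrow> br (xs @ [br ys]) = (\<Sum>i<n. br (ys[i := br (xs @ [ys ! i])]))"

locale nambu_lie_algebra = nambu_algebra scale n V br
  for scale :: "'k::field \<Rightarrow> 'v::ab_group_add \<Rightarrow> 'v" and n V br +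
  assumes bracket_skew:
    "\<lbrakk>\<sigma> permutes {..<n}; length xs = n; set xs \<subseteq> V\<rbrakk>
      \<Longrightarrow> br (permute_list \<sigma> xs) = scale (of_int (sign \<sigma>)) (br xs)"

text \<open>
  Nondegeneracy means that the radical is trivial; no finite-dimensionality is assumed.
\<close>

locale quadratic_nambu_algebra = nambu_algebra scale n V br
  for scale :: "'k::field \<Rightarrow> 'v::ab_group_add \<Rightarrow> 'v" and n V br +
  fixes B :: "'v \<Rightarrow> 'v \<Rightarrow> 'k"
  assumes form_add_left:
      "\<lbrakk>a \<in> V; b \<in> V; c \<in> V\<rbrakk> \<Longrightarrow> B (a + b) c = B a c + B b c"
    and form_add_right:
      "\<lbrakk>a \<in> V; b \<in> V; c \<in> V\<rbrakk> \<Longrightarrow> B a (b + c) = B a b + B a c"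
    and form_scale_left:
      "\<lbrakk>a \<in> V; b \<in> V\<rbrakk> \<Longrightarrow> B (scale r a) b = r * B a b"
    and form_scale_right:
      "\<lbrakk>a \<in> V; b \<in> V\<rbrakk> \<Longrightarrow> B a (scale r b) = r * B a b"
    and form_sym:
      "\<lbrakk>a \<in> V; b \<in> V\<rbrakk> \<Longrightarrow> B a b = B b a"
    and form_nondegenerate:
      "\<lbrakk>a \<in> V; \<And>b. b \<in> V \<Longrightarrow> B a b = 0\<rbrakk> \<Longrightarrow> a = 0"
    and form_invariant:
      "\<lbrakk>length xs = n - 1; set xs \<subseteq> V; y \<in> V; z \<in> V\<rbrakk>
        \<Longrightarrow> B (br (xs @ [y])) z + B y (br (xs @ [z])) = 0"

locale quadratic_nambu_lie_algebra =
  nambu_lie_algebra scale n V br + quadratic_nambu_algebra scale n V br B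
  for scale :: "'k::field \<Rightarrow> 'v::ab_group_add \<Rightarrow> 'v" and n V br B

text \<open>
  The full algebraic dual of the space carried by the whole type, as a subspace of the
  functions with pointwise operations.
\<close>

definition dual_space :: "('k::field \<Rightarrow> 'v::ab_group_add \<Rightarrow> 'v) \<Rightarrow> ('v \<Rightarrow> 'k) set" where
  "dual_space scale = {f. Vector_Spaces.linear scale (*) f}"

definition dual_scale :: "'k::field \<Rightarrow> ('v \<Rightarrow> 'k) \<Rightarrow> 'v \<Rightarrow> 'k" where
  "dual_scale c f = (\<lambda>z. c * f z)"

text \<open>The element \<open>x + f\<close> of the direct sum is the pair \<open>(x, f)\<close>.\<close>

definition ext_space ::
    "('k::field \<Rightarrow> 'v::ab_group_add \<Rightarrow> 'v) \<Rightarrow> ('v \<times> ('v \<Rightarrow> 'k)) set" where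
  "ext_space scale = UNIV \<times> dual_space scale"

definition ext_scale ::
    "('k::field \<Rightarrow> 'v::ab_group_add \<Rightarrow> 'v) \<Rightarrow> 'k \<Rightarrow> 'v \<times> ('v \<Rightarrow> 'k) \<Rightarrow> 'v \<times> ('v \<Rightarrow> 'k)" where
  "ext_scale scale c u = (scale c (fst u), dual_scale c (snd u))"

definition left_mult :: "('v list \<Rightarrow> 'v) \<Rightarrow> 'v list \<Rightarrow> 'v \<Rightarrow> 'v" where
  "left_mult br xs z = br (xs @ [z])"

definition omit_nth :: "nat \<Rightarrow> 'a list \<Rightarrow> 'a list" where
  "omit_nth i xs = take i xs @ drop (Suc i) xs"

text \<open>Position \<open>i\<close> is the mathematical index \<open>i + 1\<close>, whence \<open>Suc i\<close> in the sign.\<close>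

definition ext_bracket ::
    "nat \<Rightarrow> ('v::ab_group_add list \<Rightarrow> 'v) \<Rightarrow>
      ('v \<times> ('v \<Rightarrow> 'k::field)) list \<Rightarrow> 'v \<times> ('v \<Rightarrow> 'k)" where
  "ext_bracket n br us =
    (br (map fst us),
     \<Sum>i<n. dual_scale ((- 1) ^ (Suc i + n + 1))
              (snd (us ! i) \<circ> left_mult br (omit_nth i (map fst us))))"

definition ext_form ::
    "('v \<Rightarrow> 'v \<Rightarrow> 'k::field) \<Rightarrow> 'v \<times> ('v \<Rightarrow> 'k) \<Rightarrow> 'v \<times> ('v \<Rightarrow> 'k) \<Rightarrow> 'k" where
  "ext_form B u v = B (fst u) (fst v) + snd u (fst v) + snd v (fst u)"

end

theory Submission
  imports Defs
begin

text \<open>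
  By skew-symmetry the functional part of the bracket of \<open>L\<close> is
  \<open>z \<mapsto> - (\<Sum>i. f\<^sub>i [x\<^sub>1, \<dots>, z, \<dots>, x\<^sub>n])\<close> with \<open>z\<close> in place of \<open>x\<^sub>i\<close>, the coadjoint action.
  In the Nambu identity for \<open>L\<close>, evaluated at \<open>z\<close>, the terms containing the functionals of the
  inner bracket cancel by the Nambu identity of \<open>N\<close>, and those containing the functionals of the
  outer arguments cancel because of
  \<open>[x\<^sub>1, \<dots>, z, \<dots>, x\<^sub>n\<^sub>-\<^sub>1, [y\<^sub>1, \<dots>, y\<^sub>n]] = - (\<Sum>i. [x\<^sub>1, \<dots>, [y\<^sub>1, \<dots>, z, \<dots>, y\<^sub>n], \<dots>, x\<^sub>n\<^sub>-\<^sub>1, y\<^sub>i])\<close>.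
  The latter is adjoint to the Nambu identity with respect to \<open>B\<close>, so it follows from
  invariance and nondegeneracy.
\<close>

section \<open>Finite sums\<close>

lemma sum_fun_apply: "(\<Sum>i\<in>A. F i) z = (\<Sum>i\<in>A. F i z)"
  by (induction A rule: infinite_finite_induct) auto

text \<open>Keeping the other terms in a sum over all of \<open>A\<close>, with zero at
  \<open>i\<close>, lets off-diagonal double sums be exchanged by \<open>sum.swap\<close>.\<close>

lemma sum_split_at:
  fixes g :: "'i \<Rightarrow> 'a::comm_monoid_add"
  assumes "finite A" "i \<in> A"
  shows "sum g A = g i + (\<Sum>k\<in>A. if k = i then 0 else g k)"
proof -
  have "sum g A = g i + sum g (A - {i})"
    using assms by (rule sum.remove)
  also have "sum g (A - {i}) = (\<Sum>k\<in>A. if k = i then 0 else g k)"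
    using assms by (intro sum.mono_neutral_cong_left) auto
  finally show ?thesis .
qed

section \<open>Linear functionals and the vector space \<open>ext_space\<close>\<close>

context vector_space
begin

lemma dual_spaceD:
  assumes "f \<in> dual_space scale"
  shows "f (x + y) = f x + f y" "f (scale c x) = c * f x" "f 0 = 0" "f (- x) = - f x"
    "f (x - y) = f x - f y" "f (\<Sum>i\<in>A. F i) = (\<Sum>i\<in>A. f (F i))"
proof -
  interpret f: Vector_Spaces.linear scale "(*)" f
    using assms by (simp add: dual_space_def)
  show "f (x + y) = f x + f y" "f (scale c x) = c * f x" "f 0 = 0" "f (- x) = - f x"
    "f (x - y) = f x - f y" "f (\<Sum>i\<in>A. F i) = (\<Sum>i\<in>A. f (F i))"
    by (simp_all add: f.add f.scale f.neg f.diff f.sum)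
qed

lemma dual_spaceI:
  assumes "\<And>x y. f (x + y) = f x + f y" "\<And>c x. f (scale c x) = c * f x"
  shows "f \<in> dual_space scale"
proof -
  have "Vector_Spaces.linear scale (*) f"
    by (unfold_locales) (use assms in \<open>simp_all add: algebra_simps\<close>)
  then show ?thesis by (simp add: dual_space_def)
qed

lemma vector_space_ext_scale: "vector_space (ext_scale scale)"
  by unfold_locales
    (auto simp: ext_scale_def dual_scale_def prod_eq_iff fun_eq_iff algebra_simps)

lemma subspace_ext_space: "module.subspace (ext_scale scale) (ext_space scale)"
proof -
  interpret ext: vector_space "ext_scale scale"
    by (rule vector_space_ext_scale)
  show ?thesis
    unfolding ext.subspace_def
    by (auto simp: ext_space_def ext_scale_def dual_scale_def dual_spaceD zero_prod_def algebra_simps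
        intro!: dual_spaceI)
qed

end

context quadratic_nambu_lie_algebra
begin

text \<open>\<open>dual_space\<close> consists of functionals on the whole type, so the algebra has
  to be carried by the whole type.\<close>

context
  assumes V_UNIV: "V = UNIV"
begin

lemma br_add:
  "length xs = n \<Longrightarrow> i < n \<Longrightarrow> br (xs[i := a + b]) = br (xs[i := a]) + br (xs[i := b])"
  using bracket_add by (simp add: V_UNIV)

lemma br_scale:
  "length xs = n \<Longrightarrow> i < n \<Longrightarrow> br (xs[i := scale c a]) = scale c (br (xs[i := a]))"
  using bracket_scale by (simp add: V_UNIV)

lemma br_nambu:
  "length xs = n - 1 \<Longrightarrow> length ys = n \<Longrightarrow>
    br (xs @ [br ys]) = (\<Sum>i<n. br (ys[i := br (xs @ [ys ! i])]))"
  using nambu_identity by (simp add: V_UNIV)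

lemma form_simps:
  "B (a + b) c = B a c + B b c" "B a (b + c) = B a b + B a c"
  "B (scale r a) b = r * B a b" "B a (scale r b) = r * B a b"
  using form_add_left form_add_right form_scale_left form_scale_right by (simp_all add: V_UNIV)

text \<open>Makes the rules \<open>dual_spaceD\<close> for zero, negatives and sums available in
  either argument of \<open>B\<close>.\<close>

lemma form_in_dual: "B a \<in> dual_space scale" "(\<lambda>x. B x a) \<in> dual_space scale"
  by (auto intro!: dual_spaceI simp: form_simps)

lemma form_eqI:
  assumes "\<And>w. B a w = B b w"
  shows "a = b"
proof -
  have "a - b = 0"
    by (rule form_nondegenerate)
      (use assms dual_spaceD(5)[OF form_in_dual(2)] in \<open>auto simp: V_UNIV\<close>)
  then show ?thesis by simp
qed

section \<open>Skew-symmetry, invariance and the adjoint Nambu identity\<close>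

lemma br_swap:
  assumes "length xs = n" "i < n" "j < n" "i \<noteq> j"
  shows "br (xs[i := a, j := b]) = - br (xs[i := b, j := a])"
proof -
  let ?p = "Transposition.transpose i j"
  have p: "?p permutes {..<n}"
    using assms by (intro permutes_swap_id) auto
  have "permute_list ?p (xs[i := b, j := a]) = xs[i := a, j := b]"
    using assms p
    by (intro nth_equalityI)
      (auto simp: permute_list_nth nth_list_update Transposition.transpose_def)
  moreover have "br (permute_list ?p (xs[i := b, j := a])) =
      scale (of_int (sign ?p)) (br (xs[i := b, j := a]))"
    using assms p by (intro bracket_skew) (auto simp: V_UNIV)
  ultimately show ?thesis
    using assms by (simp add: sign_swap_id)
qed

lemma br_swap_adjacent:
  assumes "length (as @ a # b # cs) = n"
  shows "br (as @ a # b # cs) = - br (as @ b # a # cs)"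
  using br_swap[of "as @ a # b # cs" "length as" "Suc (length as)" a b] assms
  by (simp add: list_update_append)

text \<open>Each adjacent swap contributes one sign. The entry passed joins the prefix
  \<open>as\<close>, which is therefore arbitrary in the induction.\<close>

lemma br_move_last:
  assumes "length (as @ z # cs) = n"
  shows "br (as @ cs @ [z]) = scale ((- 1) ^ length cs) (br (as @ z # cs))"
  using assms
proof (induction cs arbitrary: as)
  case (Cons c cs)
  then show ?case
    using Cons.IH[of "as @ [c]"] br_swap_adjacent[of as c z cs] by simp
qed simp

text \<open>Turns the omission in \<open>ext_bracket\<close> into a replacement in place: on its way
  from position \<open>i\<close> to the end, \<open>z\<close> passes \<open>n - Suc i\<close>
  entries.\<close>

lemma br_omit_nth:
  assumes "length xs = n" "i < n"
  shows "br (omit_nth i xs @ [z]) = scale ((- 1) ^ (n - Suc i)) (br (xs[i := z]))"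
  using br_move_last[of "take i xs" z "drop (Suc i) xs"] assms
  by (simp add: omit_nth_def upd_conv_take_nth_drop)

text \<open>Invariance is assumed for the last position only. Moving \<open>y\<close> and
  \<open>z\<close> there costs the same sign, a nonzero common factor.\<close>

lemma form_invariant_nth:
  assumes "length xs = n" "i < n"
  shows "B (br (xs[i := y])) z = - B y (br (xs[i := z]))"
proof -
  have "B (br (omit_nth i xs @ [y])) z + B y (br (omit_nth i xs @ [z])) = 0"
    using assms by (intro form_invariant) (auto simp: V_UNIV omit_nth_def)
  then have "(- 1) ^ (n - Suc i) * (B (br (xs[i := y])) z + B y (br (xs[i := z]))) = 0"
    using assms by (simp add: br_omit_nth form_simps algebra_simps)
  then show ?thesis by (simp add: eq_neg_iff_add_eq_0)
qed

text \<open>After pairing with \<open>w\<close>, invariance at position \<open>j\<close> exchanges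
  \<open>z\<close> for \<open>w\<close>, so that the Nambu identity applies. Invariance in
  \<open>ys\<close> at \<open>i\<close> and then again in \<open>xs\<close> at \<open>j\<close>
  brings \<open>w\<close> back out.\<close>

lemma br_nambu_adjoint:
  assumes "length xs = n - 1" "length ys = n" "j < n - 1"
  shows "br (xs[j := z] @ [br ys]) = - (\<Sum>i<n. br (xs[j := br (ys[i := z])] @ [ys ! i]))"
proof (rule form_eqI)
  fix w
  have upd: "xs[j := a] @ [b] = (xs @ [b])[j := a]" for a b
    using assms by (simp add: list_update_append)
  note inv = form_invariant_nth[of "xs @ [_]" j, folded upd]
  have "B (br (xs[j := z] @ [br ys])) w = - B z (br (xs[j := w] @ [br ys]))"
    using assms by (subst inv) auto
  also have "\<dots> = - (\<Sum>i<n. B z (br (ys[i := br (xs[j := w] @ [ys ! i])])))"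
    using assms by (simp add: br_nambu dual_spaceD[OF form_in_dual(1)])
  also have "\<dots> = (\<Sum>i<n. B (br (ys[i := z])) (br (xs[j := w] @ [ys ! i])))"
    using assms by (simp add: form_invariant_nth[of ys] sum_negf)
  also have "\<dots> = - (\<Sum>i<n. B (br (xs[j := br (ys[i := z])] @ [ys ! i])) w)"
    using assms by (subst inv) (auto simp: sum_negf)
  also have "\<dots> = B (- (\<Sum>i<n. br (xs[j := br (ys[i := z])] @ [ys ! i]))) w"
    by (simp add: dual_spaceD[OF form_in_dual(2)])
  finally show "B (br (xs[j := z] @ [br ys])) w = \<dots>" .
qed

section \<open>The extended bracket: coadjoint form, closure and multilinearity\<close>

lemma ext_spaceD: "set us \<subseteq> ext_space scale \<Longrightarrow> i < length us \<Longrightarrow> snd (us ! i) \<in> dual_space scale"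
  using nth_mem by (fastforce simp: ext_space_def)

lemma fst_ext_bracket: "fst (ext_bracket n br us) = br (map fst us)"
  by (simp add: ext_bracket_def)

lemma snd_ext_bracket:
  assumes "length us = n" "set us \<subseteq> ext_space scale"
  shows "snd (ext_bracket n br us) z = - (\<Sum>i<n. snd (us ! i) (br ((map fst us)[i := z])))"
proof -
  have "(- 1) ^ (Suc i + n + 1) * snd (us ! i) (br (omit_nth i (map fst us) @ [z])) =
      - snd (us ! i) (br ((map fst us)[i := z]))" if "i < n" for i
  proof -
    \<comment> \<open>The sign in the definition and the sign of moving \<open>z\<close> back to
      position \<open>i\<close> have an odd total exponent, so every summand gets the sign
      -1.\<close>
    have "Suc i + n + 1 + (n - Suc i) = Suc (2 * n)"
      using that by simp
    then have "(- 1 :: 'k) ^ (Suc i + n + 1) * (- 1) ^ (n - Suc i) = - 1"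
      by (simp only: power_add[symmetric]) simp
    then show ?thesis
      using that assms dual_spaceD(2)[OF ext_spaceD[OF assms(2)]]
      by (simp only: br_omit_nth length_map mult.assoc[symmetric]) simp
  qed
  then show ?thesis
    by (simp add: ext_bracket_def sum_fun_apply dual_scale_def left_mult_def sum_negf
        del: power_Suc)
qed

lemma ext_space_update:
  "set us \<subseteq> ext_space scale \<Longrightarrow> a \<in> ext_space scale \<Longrightarrow> set (us[i := a]) \<subseteq> ext_space scale"
  using set_update_subset_insert by fastforce

lemma ext_bracket_closed:
  assumes "length us = n" "set us \<subseteq> ext_space scale"
  shows "ext_bracket n br us \<in> ext_space scale"
proof -
  have "snd (ext_bracket n br us) \<in> dual_space scale"
    using assms dual_spaceD[OF ext_spaceD[OF assms(2)]]
    by (intro dual_spaceI)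
      (simp_all add: snd_ext_bracket br_add br_scale sum.distrib sum_distrib_left)
  then show ?thesis by (simp add: ext_space_def mem_Times_iff)
qed

lemma ext_bracket_add:
  assumes "length us = n" "set us \<subseteq> ext_space scale" "i < n"
    and "a \<in> ext_space scale" "b \<in> ext_space scale"
  shows "ext_bracket n br (us[i := a + b]) = ext_bracket n br (us[i := a]) + ext_bracket n br (us[i := b])"
proof -
  interpret ext: vector_space "ext_scale scale"
    by (rule vector_space_ext_scale)
  have ab: "a + b \<in> ext_space scale"
    using assms subspace_ext_space ext.subspace_add by blast
  \<comment> \<open>For \<open>k = i\<close> the vector at position \<open>i\<close> is overwritten
    by \<open>z\<close> and only the functional varies; for \<open>k \<noteq> i\<close> only the
    vector varies, and the bracket is additive in it.\<close>
  have "snd (us[i := a + b] ! k) (br ((map fst (us[i := a + b]))[k := z])) =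
      snd (us[i := a] ! k) (br ((map fst (us[i := a]))[k := z])) +
      snd (us[i := b] ! k) (br ((map fst (us[i := b]))[k := z]))" if "k < n" for k z
    using assms that dual_spaceD(1)[OF ext_spaceD[OF assms(2)]]
    by (cases "k = i") (simp_all add: map_update list_update_swap[of i k] br_add)
  then show ?thesis
    using assms ab
    by (simp add: prod_eq_iff fun_eq_iff fst_ext_bracket snd_ext_bracket ext_space_update
        sum.distrib)
      (simp add: map_update br_add)
qed

lemma ext_bracket_scale:
  assumes "length us = n" "set us \<subseteq> ext_space scale" "i < n" "a \<in> ext_space scale"
  shows "ext_bracket n br (us[i := ext_scale scale c a]) = ext_scale scale c (ext_bracket n br (us[i := a]))"
proof -
  interpret ext: vector_space "ext_scale scale"
    by (rule vector_space_ext_scale)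
  have ca: "ext_scale scale c a \<in> ext_space scale"
    using assms subspace_ext_space ext.subspace_scale by blast
  have "snd (us[i := ext_scale scale c a] ! k) (br ((map fst (us[i := ext_scale scale c a]))[k := z])) =
      c * snd (us[i := a] ! k) (br ((map fst (us[i := a]))[k := z]))" if "k < n" for k z
    using assms that dual_spaceD(2)[OF ext_spaceD[OF assms(2)]]
    by (cases "k = i")
      (simp_all add: map_update list_update_swap[of i k] br_scale ext_scale_def dual_scale_def)
  then show ?thesis
    using assms ca
    by (simp add: prod_eq_iff fun_eq_iff fst_ext_bracket snd_ext_bracket ext_space_update
        sum_distrib_left ext_scale_def[of _ _ "ext_bracket _ _ _"] dual_scale_def)
      (simp add: map_update br_scale ext_scale_def)
qed

text \<open>Separates the last argument, which the Nambu identity and invariance treat differently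
  from the others.\<close>

lemma snd_ext_bracket_snoc:
  assumes "length us = n - 1" "set us \<subseteq> ext_space scale" "v \<in> ext_space scale"
  shows "snd (ext_bracket n br (us @ [v])) z =
    - (\<Sum>j<n - 1. snd (us ! j) (br ((map fst us)[j := z] @ [fst v]))) - snd v (br (map fst us @ [z]))"
proof -
  obtain m where m: "n = Suc m"
    using arity by (cases n) auto
  have "snd (ext_bracket n br (us @ [v])) z =
      - (\<Sum>i<n. snd ((us @ [v]) ! i) (br ((map fst (us @ [v]))[i := z])))"
    using assms m by (intro snd_ext_bracket) auto
  also have "(\<Sum>i<n. snd ((us @ [v]) ! i) (br ((map fst (us @ [v]))[i := z]))) =
      (\<Sum>j<n - 1. snd (us ! j) (br ((map fst us)[j := z] @ [fst v]))) + snd v (br (map fst us @ [z]))"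
    using assms m by (simp add: nth_append list_update_append)
  finally show ?thesis by simp
qed

section \<open>The Nambu identity of the extension\<close>

lemma ext_nambu_identity:
  assumes us: "length us = n - 1" "set us \<subseteq> ext_space scale"
    and vs: "length vs = n" "set vs \<subseteq> ext_space scale"
  shows "ext_bracket n br (us @ [ext_bracket n br vs]) =
    (\<Sum>i<n. ext_bracket n br (vs[i := ext_bracket n br (us @ [vs ! i])]))"
proof -
  define xs ys where "xs = map fst us" and "ys = map fst vs"
  have len: "length xs = n - 1" "length ys = n"
    using us vs by (simp_all add: xs_def ys_def)
  have vs_in: "vs ! i \<in> ext_space scale" if "i < n" for i
    using vs that by (auto dest: nth_mem)
  have inner_in: "ext_bracket n br (us @ [vs ! i]) \<in> ext_space scale" if "i < n" for i
    using us vs_in[OF that] arity by (intro ext_bracket_closed) auto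
  note lin_us = dual_spaceD[OF ext_spaceD[OF us(2)]]
    and lin_vs = dual_spaceD[OF ext_spaceD[OF vs(2)]]
  have fst_eq: "br (xs @ [br ys]) = (\<Sum>i<n. br (ys[i := br (xs @ [ys ! i])]))"
    using len by (rule br_nambu)
  have "snd (ext_bracket n br (us @ [ext_bracket n br vs])) z =
      (\<Sum>i<n. snd (ext_bracket n br (vs[i := ext_bracket n br (us @ [vs ! i])])) z)" for z
  proof -
    \<comment> \<open>\<open>F\<close> collects the functionals of the outer arguments.
      \<open>G\<close> and \<open>H\<close> carry those of \<open>vs\<close>; only off-diagonal
      values of \<open>G\<close> will enter.\<close>
    define F where "F i = (\<Sum>j<n - 1. snd (us ! j) (br (xs[j := br (ys[i := z])] @ [ys ! i])))" for i
    define G where "G i k = snd (vs ! k) (br (ys[i := br (xs @ [ys ! i]), k := z]))" for i k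
    define H where "H i = snd (vs ! i) (br (xs @ [br (ys[i := z])]))" for i
    have g: "snd (vs ! k) (br (ys[k := br (xs @ [z])])) =
        H k - (\<Sum>i<n. if i = k then 0 else G i k)" if "k < n" for k
    proof -
      \<comment> \<open>The Nambu identity for \<open>ys\<close> with \<open>z\<close> at position
        \<open>k\<close>; its summand \<open>i = k\<close> is the term wanted.\<close>
      have "br (xs @ [br (ys[k := z])]) =
          (\<Sum>i<n. br (ys[k := z, i := br (xs @ [ys[k := z] ! i])]))"
        using len by (subst br_nambu) auto
      also have "\<dots> = br (ys[k := br (xs @ [z])]) +
          (\<Sum>i<n. if i = k then 0 else br (ys[i := br (xs @ [ys ! i]), k := z]))"
        using len that
        by (subst sum_split_at[where i = k])
          (auto intro!: sum.cong simp: list_update_swap)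
      finally have "H k = snd (vs ! k) (br (ys[k := br (xs @ [z])])) +
          (\<Sum>i<n. snd (vs ! k) (if i = k then 0 else br (ys[i := br (xs @ [ys ! i]), k := z])))"
        using vs that by (simp add: H_def lin_vs)
      also have "(\<Sum>i<n. snd (vs ! k) (if i = k then 0 else br (ys[i := br (xs @ [ys ! i]), k := z])))
          = (\<Sum>i<n. if i = k then 0 else G i k)"
        using vs that by (intro sum.cong) (auto simp: G_def lin_vs)
      finally show ?thesis by simp
    qed
    have f: "snd (us ! j) (br (xs[j := z] @ [br ys])) =
        - (\<Sum>i<n. snd (us ! j) (br (xs[j := br (ys[i := z])] @ [ys ! i])))" if "j < n - 1" for j
      using us that len by (simp add: br_nambu_adjoint lin_us)
    have "snd (ext_bracket n br (us @ [ext_bracket n br vs])) z =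
        - (\<Sum>j<n - 1. snd (us ! j) (br (xs[j := z] @ [br ys]))) +
        (\<Sum>k<n. snd (vs ! k) (br (ys[k := br (xs @ [z])])))"
      using us vs
      by (simp add: snd_ext_bracket_snoc ext_bracket_closed fst_ext_bracket snd_ext_bracket
          xs_def ys_def)
    also have "\<dots> = (\<Sum>i<n. F i) + (\<Sum>i<n. H i) - (\<Sum>i<n. \<Sum>k<n. if k = i then 0 else G i k)"
    proof -
      have "(\<Sum>j<n - 1. snd (us ! j) (br (xs[j := z] @ [br ys]))) = - (\<Sum>i<n. F i)"
        unfolding F_def by (subst sum.swap) (simp add: f sum_negf)
      moreover have "(\<Sum>k<n. snd (vs ! k) (br (ys[k := br (xs @ [z])]))) =
          (\<Sum>k<n. H k) - (\<Sum>k<n. \<Sum>i<n. if k = i then 0 else G i k)"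
        by (simp add: g sum_subtractf eq_commute)
      ultimately show ?thesis
        by (subst sum.swap) simp
    qed
    finally have lhs: "snd (ext_bracket n br (us @ [ext_bracket n br vs])) z = \<dots>" .
    \<comment> \<open>In the \<open>i\<close>-th summand on the right, position \<open>i\<close>
      carries the functional of the inner bracket, which yields \<open>F i\<close> and
      \<open>H i\<close>; the other positions keep their functionals and yield
      \<open>G i k\<close>.\<close>
    have "snd (ext_bracket n br (vs[i := ext_bracket n br (us @ [vs ! i])])) z =
        F i + H i - (\<Sum>k<n. if k = i then 0 else G i k)" if "i < n" for i
    proof -
      let ?w = "ext_bracket n br (us @ [vs ! i])"
      have fst_w: "fst ?w = br (xs @ [ys ! i])"
        using vs that by (simp add: fst_ext_bracket xs_def ys_def)
      have "snd (ext_bracket n br (vs[i := ?w])) z =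
          - (\<Sum>k<n. snd (vs[i := ?w] ! k) (br (ys[i := br (xs @ [ys ! i]), k := z])))"
        using vs inner_in[OF that]
        by (simp add: snd_ext_bracket ext_space_update map_update fst_w ys_def)
      also have "(\<Sum>k<n. snd (vs[i := ?w] ! k) (br (ys[i := br (xs @ [ys ! i]), k := z]))) =
          snd ?w (br (ys[i := z])) + (\<Sum>k<n. if k = i then 0 else G i k)"
        using that vs by (subst sum_split_at[where i = i]) (auto intro!: sum.cong simp: G_def)
      also have "snd ?w (br (ys[i := z])) = - F i - H i"
        using us vs that vs_in[OF that] by (simp add: snd_ext_bracket_snoc F_def H_def xs_def ys_def)
      finally show ?thesis by simp
    qed
    then show ?thesis
      by (simp add: lhs sum.distrib sum_subtractf)
  qed
  moreover have "fst (ext_bracket n br (vs[i := ext_bracket n br (us @ [vs ! i])])) =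
      br (ys[i := br (xs @ [ys ! i])])" if "i < n" for i
    using vs that by (simp add: fst_ext_bracket map_update xs_def ys_def)
  ultimately show ?thesis
    using fst_eq
    by (simp add: prod_eq_iff fun_eq_iff fst_sum snd_sum sum_fun_apply)
      (simp add: fst_ext_bracket xs_def ys_def)
qed

section \<open>Invariance and nondegeneracy of the extended form\<close>

lemma ext_form_invariant:
  assumes us: "length us = n - 1" "set us \<subseteq> ext_space scale"
    and "v \<in> ext_space scale" "w \<in> ext_space scale"
  shows "ext_form B (ext_bracket n br (us @ [v])) w + ext_form B v (ext_bracket n br (us @ [w])) = 0"
proof -
  let ?xs = "map fst us"
  have "snd (us ! j) (br (?xs[j := fst w] @ [fst v])) = - snd (us ! j) (br (?xs[j := fst v] @ [fst w]))"
    if "j < n - 1" for j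
  proof -
    \<comment> \<open>Swapping positions \<open>j\<close> and \<open>n - 1\<close> makes the
      functionals of \<open>us\<close> cancel between the two halves.\<close>
    have "br (?xs[j := fst w] @ [fst v]) = - br (?xs[j := fst v] @ [fst w])"
      using br_swap[of "?xs @ [fst v]" j "n - 1" "fst w" "fst v"] us that
      by (simp add: list_update_append)
    then show ?thesis
      using us that by (simp add: dual_spaceD[OF ext_spaceD[OF us(2)]])
  qed
  then have "(\<Sum>j<n - 1. snd (us ! j) (br (?xs[j := fst w] @ [fst v]))) =
      - (\<Sum>j<n - 1. snd (us ! j) (br (?xs[j := fst v] @ [fst w])))"
    by (simp add: sum_negf)
  moreover have "B (br (?xs @ [fst v])) (fst w) + B (fst v) (br (?xs @ [fst w])) = 0"
    using us by (intro form_invariant) (auto simp: V_UNIV)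
  ultimately show ?thesis
    using assms
    by (simp add: ext_form_def fst_ext_bracket snd_ext_bracket_snoc algebra_simps)
qed

lemma ext_form_nondegenerate:
  assumes a: "a \<in> ext_space scale" "\<And>b. b \<in> ext_space scale \<Longrightarrow> ext_form B a b = 0"
  shows "a = 0"
proof -
  have sub: "(\<lambda>_. 0) \<in> dual_space scale"
    by (rule dual_spaceI) auto
  have snd_a: "snd a \<in> dual_space scale"
    using a by (auto simp: ext_space_def)
  \<comment> \<open>The functionals \<open>\<lambda>x. B x y\<close> already separate points since
    \<open>B\<close> is nondegenerate, so they suffice as test elements in any dimension.\<close>
  have "B (fst a) y = B 0 y" for y
    using a(2)[of "(0, \<lambda>x. B x y)"] form_in_dual dual_spaceD(3)[OF form_in_dual(1)]
      dual_spaceD(3)[OF form_in_dual(2)] dual_spaceD(3)[OF snd_a]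
    by (simp add: ext_form_def ext_space_def)
  then have "fst a = 0" by (rule form_eqI)
  \<comment> \<open>With \<open>fst a = 0\<close>, pairing with the vector \<open>y\<close> alone
    evaluates \<open>snd a\<close> at \<open>y\<close>.\<close>
  moreover have "snd a y = 0" for y
    using a(2)[of "(y, \<lambda>_. 0)"] sub \<open>fst a = 0\<close> dual_spaceD(3)[OF form_in_dual(2)]
    by (simp add: ext_form_def ext_space_def)
  ultimately show ?thesis by (simp add: prod_eq_iff fun_eq_iff)
qed

lemma quadratic_nambu_algebra_ext:
  "quadratic_nambu_algebra (ext_scale scale) n (ext_space scale) (ext_bracket n br) (ext_form B)"
proof -
  interpret ext: vector_space "ext_scale scale"
    by (rule vector_space_ext_scale)
  have dual: "snd a \<in> dual_space scale" if "a \<in> ext_space scale" for a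
    using that by (auto simp: ext_space_def)
  show ?thesis
  proof
    fix a b assume "a \<in> ext_space scale" "b \<in> ext_space scale"
    show "ext_form B a b = ext_form B b a"
      using form_sym by (simp add: ext_form_def V_UNIV)
  qed (use arity subspace_ext_space ext_bracket_closed ext_bracket_add ext_bracket_scale
      ext_nambu_identity ext_form_invariant ext_form_nondegenerate in
      \<open>auto simp: ext_form_def ext_scale_def dual_scale_def form_simps dual dual_spaceD(1,2)[OF dual]
        algebra_simps\<close>)
qed

end

end

theorem theorem5p3:
  fixes scale :: "'k::{alg_closed_field, field_char_0} \<Rightarrow> 'v::ab_group_add \<Rightarrow> 'v"
    and n :: nat
    and br :: "'v list \<Rightarrow> 'v"
    and B :: "'v \<Rightarrow> 'v \<Rightarrow> 'k"
  assumes "quadratic_nambu_lie_algebra scale n UNIV br B"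
  shows "quadratic_nambu_algebra (ext_scale scale) n (ext_space scale)
           (ext_bracket n br) (ext_form B)"
  using assms by (rule quadratic_nambu_lie_algebra.quadratic_nambu_algebra_ext) simp

end
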